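(* Let $\lambda>1$ and $\delta\neq 0$ be real numbers. Let $f\in C^\infty([1,\lambda])$ be a real-valued function such that $f^{(n)}(1)=f^{(n)}(\lambda)=0$ for every integer $n\ge 0$. Then $f$ extends in a unique way to a function of class $C^\infty$ on $[0,\infty[$ satisfying $$\int_0^{\lambda x} f(t)\,dt=\delta\,\big(f(x)-f(0)\big)\qquad\text{for all } x\ge 0.$$
   Context: $f^{(0)}=f$. Derivatives at endpoints of closed intervals are one-sided. *)

theory Defs
  imports "HOL-Analysis.Analysis"
begin

(* Derivatives are taken within S: one-sided at an endpoint of an interval S. The result is
   meaningful only at points of S that are limit points of S; values elsewhere are irrelevant. *)
primrec nth_deriv_within :: "real set \<Rightarrow> nat \<Rightarrow> (real \<Rightarrow> real) \<Rightarrow> real \<Rightarrow> real" where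
  "nth_deriv_within S 0 f = f"
| "nth_deriv_within S (Suc n) f =
     (\<lambda>x. vector_derivative (nth_deriv_within S n f) (at x within S))"

(* Continuity of every derivative is implied by its differentiability. *)
definition smooth_on :: "real set \<Rightarrow> (real \<Rightarrow> real) \<Rightarrow> bool" where
  "smooth_on S f \<longleftrightarrow> (\<forall>n. nth_deriv_within S n f differentiable_on S)"

(* F represents a function on the half-line: only its values on {0..} matter. *)
definition smooth_solution_extending ::
    "real \<Rightarrow> real \<Rightarrow> (real \<Rightarrow> real) \<Rightarrow> (real \<Rightarrow> real) \<Rightarrow> bool" where
  "smooth_solution_extending l \<delta> f F \<longleftrightarrow>
     smooth_on {0..} F \<and>
     (\<forall>x\<in>{1..l}. F x = f x) \<and>
     (\<forall>x\<ge>0. integral {0..l * x} F = \<delta> * (F x - F 0))"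

end

theory Submission
  imports Defs
begin

text \<open>
  On the half-line the integral equation is equivalent to the pantograph equation
  \<open>F' x = (l / \<delta>) * F (l * x)\<close>, because both sides of the integral equation vanish at 0. This
  equation determines \<open>F\<close> from its values on \<open>{1..l}\<close> in both directions. Read as
  \<open>F (l * x) = (\<delta> / l) * F' x\<close>, it yields \<open>F\<close> on \<open>{l..l\<^sup>2}\<close>, \<open>{l\<^sup>2..l\<^sup>3}\<close>, ... by differentiation; read
  as a differential equation with known right-hand side, it yields \<open>F\<close> on \<open>{1/l..1}\<close>,
  \<open>{1/l\<^sup>2..1/l}\<close>, ... by integration, the value at the right endpoint being known. Only the value at
  0 remains, and continuity gives it. Applied to the difference of two solutions this is the
  uniqueness proof (\<open>pantograph_zero\<close>).

  For existence, extend \<open>f\<close> by zero; as \<open>f\<close> is flat at 1 and \<open>l\<close>, the extension \<open>D 0\<close> is smooth on the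
  whole line (\<open>extension_by_zero_deriv\<close>). Let \<open>T\<close> be the operator
  \<open>T g x = (1 / \<delta>) * (integral of g from l to l * x)\<close>, so that \<open>(T g)' x = (l / \<delta>) * g (l * x)\<close>, and
  let \<open>T\<close> have the formal inverse \<open>g \<mapsto> (\<delta> / l) * g' (x / l)\<close>. The solution is the two-sided orbit sum
  \<open>\<Sum>j\<in>\<int>. T^j (D 0)\<close>: differentiating and rescaling shifts the index by one. The powers with
  \<open>j \<le> 0\<close> give \<open>rpart\<close>, which is locally finite since the \<open>k\<close>-th term lives on \<open>{l^k..l^(k+1)}\<close>. The positive
  powers give \<open>lpart\<close>: since \<open>T^j (D 0)\<close> is supported, within the half-line, in an interval of length
  \<open>l / l^j\<close>, the next integration gains a factor of this order, and the series converges uniformly up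
  to 0 (\<open>lterm_bounded\<close>, \<open>summable_lbound\<close>, \<open>lpart_deriv\<close>). Thus the sum satisfies the pantograph
  equation also at 0, and smoothness follows since the equation expresses each derivative of \<open>F\<close> by
  a dilation of \<open>F\<close> itself (\<open>pantograph_nth_deriv_within\<close>).
\<close>

section \<open>Calculus on the half-line\<close>

lemma at_within_half_line_neq_bot:
  fixes x :: real
  assumes "x \<ge> 0"
  shows "at x within {0..} \<noteq> bot"
proof -
  have "x islimpt {x..x + 1}" by (rule islimpt_Icc[THEN iffD2]) auto
  then have "x islimpt {0..}" by (rule islimpt_subset) (use assms in auto)
  then show ?thesis by (simp add: trivial_limit_within)
qed

lemma integral_has_real_derivative_half_line:
  fixes g :: "real \<Rightarrow> real"
  assumes "continuous_on {0..} g" "x \<ge> 0"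
  shows "((\<lambda>x. integral {0..x} g) has_real_derivative g x) (at x within {0..})"
proof -
  have "continuous_on {0..x + 1} g"
    using assms(1) by (rule continuous_on_subset) auto
  then have "((\<lambda>x. integral {0..x} g) has_real_derivative g x) (at x within {0..x + 1})"
    using assms(2) by (intro integral_has_real_derivative) auto
  moreover have "at x within {0..x + 1} = at x within {0..}"
    by (rule at_within_nhd[where S = "{..<x + 1}"]) (use assms(2) in auto)
  ultimately show ?thesis by simp
qed

lemma has_real_derivative_dilation_half_line:
  fixes F :: "real \<Rightarrow> real"
  assumes "(F has_real_derivative d) (at (c * x) within {0..})" "c > 0"
  shows "((\<lambda>x. F (c * x)) has_real_derivative d * c) (at x within {0..})"
proof -
  have "(F has_real_derivative d) (at (c * x) within (*) c ` {0..})"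
    using assms(1) by (rule DERIV_subset) (use assms(2) in auto)
  moreover have "((*) c has_real_derivative c) (at x within {0..})"
    by (auto intro!: derivative_eq_intros)
  ultimately show ?thesis
    using DERIV_image_chain[of F d "(*) c" x "{0..}" c] by (simp add: o_def)
qed

lemma integral_Icc_eq_of_vanishing:
  fixes g :: "real \<Rightarrow> real"
  assumes "continuous_on {0..} g" "0 \<le> s" "s \<le> b" "\<And>x. x \<ge> s \<Longrightarrow> g x = 0"
  shows "integral {0..b} g = integral {0..s} g"
proof -
  have "g integrable_on {0..b}"
    by (rule integrable_continuous_interval, rule continuous_on_subset[OF assms(1)]) auto
  then have "integral {0..b} g = integral {0..s} g + integral {s..b} g"
    using assms(2,3) by (simp add: Henstock_Kurzweil_Integration.integral_combine)
  moreover have "integral {s..b} g = integral {s..b} (\<lambda>_. 0)"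
    by (rule Henstock_Kurzweil_Integration.integral_cong) (use assms(4) in auto)
  ultimately show ?thesis by simp
qed

section \<open>The pantograph equation\<close>

text \<open>Unlike the integral equation, this form is local: it relates \<open>F\<close> near \<open>x\<close> to the value at \<open>l * x\<close>,
  without reference to the values near 0.\<close>
definition pantograph :: "real \<Rightarrow> real \<Rightarrow> (real \<Rightarrow> real) \<Rightarrow> bool" where
  "pantograph l \<delta> F \<longleftrightarrow>
     (\<forall>x\<ge>0. (F has_real_derivative l / \<delta> * F (l * x)) (at x within {0..}))"

lemma pantographD:
  "pantograph l \<delta> F \<Longrightarrow> x \<ge> 0 \<Longrightarrow> (F has_real_derivative l / \<delta> * F (l * x)) (at x within {0..})"
  by (simp add: pantograph_def)

lemma pantograph_continuous_on: "pantograph l \<delta> F \<Longrightarrow> continuous_on {0..} F"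
  by (meson DERIV_continuous_on atLeast_iff pantographD)

lemma pantograph_diff:
  assumes "pantograph l \<delta> F" "pantograph l \<delta> G"
  shows "pantograph l \<delta> (\<lambda>x. F x - G x)"
  unfolding pantograph_def
proof (intro allI impI)
  fix x :: real assume "x \<ge> 0"
  then show "((\<lambda>x. F x - G x) has_real_derivative l / \<delta> * (F (l * x) - G (l * x))) (at x within {0..})"
    using DERIV_diff[OF pantographD[OF assms(1)] pantographD[OF assms(2)]]
    by (simp add: right_diff_distrib)
qed

lemma pantograph_if_integral_equation:
  assumes "l > 0" "\<delta> \<noteq> 0" "continuous_on {0..} F"
    and eq: "\<And>x. x \<ge> 0 \<Longrightarrow> integral {0..l * x} F = \<delta> * (F x - F 0)"
  shows "pantograph l \<delta> F"
  unfolding pantograph_def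
proof (intro allI impI)
  fix x :: real assume x: "x \<ge> 0"
  have "((\<lambda>x. integral {0..l * x} F) has_real_derivative F (l * x) * l) (at x within {0..})"
    using integral_has_real_derivative_half_line[OF assms(3), of "l * x"] x assms(1)
    by (intro has_real_derivative_dilation_half_line[where F = "\<lambda>x. integral {0..x} F"]) auto
  then have "((\<lambda>x. integral {0..l * x} F / \<delta> + F 0) has_real_derivative l / \<delta> * F (l * x))
      (at x within {0..})"
    using assms(2) by (auto intro!: derivative_eq_intros)
  then show "(F has_real_derivative l / \<delta> * F (l * x)) (at x within {0..})"
    by (rule has_field_derivative_transform_within[of _ _ _ _ 1])
       (use x assms(2) eq in \<open>auto simp: field_simps\<close>)
qed

lemma integral_equation_if_pantograph:
  assumes "l > 0" "\<delta> \<noteq> 0" "pantograph l \<delta> F" "x \<ge> 0"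
  shows "integral {0..l * x} F = \<delta> * (F x - F 0)"
proof -
  let ?W = "\<lambda>x. \<delta> * F x - integral {0..l * x} F"
  have "(?W has_real_derivative 0) (at x within {0..})" if x: "x \<in> {0..}" for x
  proof -
    have "((\<lambda>x. integral {0..l * x} F) has_real_derivative F (l * x) * l) (at x within {0..})"
      using integral_has_real_derivative_half_line[OF pantograph_continuous_on[OF assms(3)], of "l * x"]
        x assms(1)
      by (intro has_real_derivative_dilation_half_line[where F = "\<lambda>x. integral {0..x} F"]) auto
    moreover have "((\<lambda>x. \<delta> * F x) has_real_derivative \<delta> * (l / \<delta> * F (l * x))) (at x within {0..})"
      using x by (intro DERIV_cmult pantographD[OF assms(3)]) auto
    ultimately show ?thesis
      using DERIV_diff assms(2) by fastforce
  qed
  then have "\<exists>c. \<forall>x\<in>{0..}. ?W x = c"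
    by (intro has_field_derivative_zero_constant) auto
  then have "?W x = ?W 0" using assms(4) by (metis atLeast_iff order_refl)
  then show ?thesis by (simp add: algebra_simps)
qed

lemma pantograph_dilated_deriv:
  assumes "pantograph l \<delta> F" "a > 0" "x \<ge> 0"
  shows "((\<lambda>x. c * F (a * x)) has_real_derivative c * a * (l / \<delta>) * F (l * a * x))
    (at x within {0..})"
proof -
  have "((\<lambda>x. F (a * x)) has_real_derivative l / \<delta> * F (l * (a * x)) * a) (at x within {0..})"
    using assms(2,3)
    by (intro has_real_derivative_dilation_half_line pantographD[OF assms(1)]) auto
  then have "((\<lambda>x. c * F (a * x)) has_real_derivative c * (l / \<delta> * F (l * (a * x)) * a))
      (at x within {0..})"
    by (rule DERIV_cmult)
  then show ?thesis by (simp add: mult_ac)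
qed

text \<open>Differentiating the equation only dilates the argument and multiplies by a constant, so every
  derivative of a solution is a multiple of the solution, dilated. Hence a solution that is once
  differentiable is smooth, at 0 as well.\<close>
lemma pantograph_nth_deriv_within:
  assumes "l > 0" "pantograph l \<delta> F"
  shows "\<exists>c. \<forall>x\<ge>0. nth_deriv_within {0..} n F x = c * F (l ^ n * x)"
proof (induction n)
  case 0
  show ?case by (intro exI[of _ 1]) simp
next
  case (Suc n)
  then obtain c where c: "\<And>x. x \<ge> 0 \<Longrightarrow> nth_deriv_within {0..} n F x = c * F (l ^ n * x)"
    by blast
  have "nth_deriv_within {0..} (Suc n) F x = c * l ^ n * (l / \<delta>) * F (l ^ Suc n * x)"
    if x: "x \<ge> 0" for x
  proof -
    have "((\<lambda>x. c * F (l ^ n * x)) has_real_derivative c * l ^ n * (l / \<delta>) * F (l * l ^ n * x))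
        (at x within {0..})"
      using x assms(1) by (intro pantograph_dilated_deriv[OF assms(2)]) auto
    then have "(nth_deriv_within {0..} n F has_real_derivative
        c * l ^ n * (l / \<delta>) * F (l * l ^ n * x)) (at x within {0..})"
      by (rule has_field_derivative_transform_within[of _ _ _ _ 1]) (use x c in auto)
    then show ?thesis
      using x by (simp add: has_real_derivative_iff_has_vector_derivative
        vector_derivative_within[OF at_within_half_line_neq_bot])
  qed
  then show ?case by blast
qed

lemma pantograph_smooth_on:
  assumes "l > 0" "pantograph l \<delta> F"
  shows "smooth_on {0..} F"
  unfolding smooth_on_def differentiable_on_def
proof (intro allI ballI)
  fix n and x :: real assume x: "x \<in> {0..}"
  obtain c where c: "\<And>x. x \<ge> 0 \<Longrightarrow> nth_deriv_within {0..} n F x = c * F (l ^ n * x)"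
    using pantograph_nth_deriv_within[OF assms, of n] by blast
  have "((\<lambda>x. c * F (l ^ n * x)) has_real_derivative c * l ^ n * (l / \<delta>) * F (l * l ^ n * x))
      (at x within {0..})"
    using x assms(1) by (intro pantograph_dilated_deriv[OF assms(2)]) auto
  then have "(nth_deriv_within {0..} n F has_real_derivative
      c * l ^ n * (l / \<delta>) * F (l * l ^ n * x)) (at x within {0..})"
    by (rule has_field_derivative_transform_within[of _ _ _ _ 1]) (use x c in auto)
  then show "nth_deriv_within {0..} n F differentiable (at x within {0..})"
    by (auto simp: differentiable_def has_field_derivative_def)
qed

section \<open>Uniqueness\<close>

text \<open>If a solution vanishes on an interval, so does its derivative, and the equation carries this to
  the dilated interval: this moves zeros to the right. If it vanishes on a ray, its derivative
  vanishes on the ray enlarged by the factor \<open>l\<close>, so it is constant there: this moves zeros to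
  the left.\<close>
lemma pantograph_zero:
  assumes l: "l > 1" and "\<delta> \<noteq> 0" and H: "pantograph l \<delta> H"
    and zero: "\<And>x. x \<in> {1..l} \<Longrightarrow> H x = 0" and "x \<ge> 0"
  shows "H x = 0"
proof -
  have right: "\<forall>x\<in>{1..l ^ Suc n}. H x = 0" for n
  proof (induction n)
    case 0
    then show ?case using zero by simp
  next
    case (Suc n)
    show ?case
    proof
      fix y assume y: "y \<in> {1..l ^ Suc (Suc n)}"
      show "H y = 0"
      proof (cases "y \<le> l")
        case True
        then show ?thesis using zero y by simp
      next
        case False
        define x where "x = y / l"
        have yx: "y = l * x" using l by (simp add: x_def)
        have x: "x \<in> {1..l ^ Suc n}"
          using y False l by (auto simp: x_def field_simps)
        have "(H has_real_derivative l / \<delta> * H y) (at x within {1..l ^ Suc n})"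
          unfolding yx by (rule DERIV_subset[OF pantographD[OF H]]) (use x in auto)
        \<comment> \<open>The derivative within the interval suffices, so \<open>x\<close> may be one of its endpoints.\<close>
        moreover have "(H has_real_derivative 0) (at x within {1..l ^ Suc n})"
          by (rule has_field_derivative_transform_within[of "\<lambda>_. 0" _ _ _ 1])
            (use x Suc in auto)
        moreover have "at x within {1..l ^ Suc n} \<noteq> bot"
        proof -
          have "1 < l ^ Suc n" using l by (rule one_less_power) simp
          then show ?thesis
            using islimpt_Icc[of 1 "l ^ Suc n" x] x by (simp add: trivial_limit_within)
        qed
        ultimately have "l / \<delta> * H y = 0" by (rule has_field_derivative_unique)
        then show ?thesis using l \<open>\<delta> \<noteq> 0\<close> by simp
      qed
    qed
  qed
  have left: "\<forall>x. x * l ^ n \<ge> 1 \<longrightarrow> H x = 0" for n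
  proof (induction n)
    case 0
    show ?case
    proof (intro allI impI)
      fix x :: real assume "x * l ^ 0 \<ge> 1"
      moreover obtain n where "x < l ^ n" using real_arch_pow[OF l] by blast
      moreover have "l ^ n \<le> l ^ Suc n" using l by (intro power_increasing) auto
      ultimately have "x \<in> {1..l ^ Suc n}" by (simp del: power_Suc)
      then show "H x = 0" using right[of n] by blast
    qed
  next
    case (Suc n)
    let ?s = "{1 / l ^ Suc n..}"
    have "(H has_real_derivative 0) (at x within ?s)" if x: "x \<in> ?s" for x
    proof -
      have "l * x * l ^ n \<ge> 1" using x l by (simp add: field_simps)
      then have H0: "H (l * x) = 0" using Suc by blast
      have "0 \<le> 1 / l ^ Suc n" using l by simp
      then have sub: "?s \<subseteq> {0..}" by (simp only: atLeast_subset_iff)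
      have "x \<ge> 0" using subsetD[OF sub x] by simp
      from DERIV_subset[OF pantographD[OF H this] sub] show ?thesis
        by (simp only: H0 mult_zero_right)
    qed
    then obtain c where c: "\<forall>x\<in>?s. H x = c"
      using has_field_derivative_zero_constant[of ?s H] by auto
    have "1 \<le> l ^ Suc n" using l by (intro one_le_power) simp
    then have "1 \<in> ?s" by (simp del: power_Suc)
    then have "c = 0" using c zero[of 1] l by fastforce
    then show ?case using c l by (auto simp: field_simps)
  qed
  have pos: "H x = 0" if "x > 0" for x
  proof -
    obtain n where "1 / x < l ^ n" using real_arch_pow[OF l] by blast
    then have "x * l ^ n \<ge> 1" using that by (simp add: field_simps)
    then show ?thesis using left by blast
  qed
  show ?thesis
    by (rule continuous_constant_on_closure[of "{0<..}" H 0 x])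
      (use pos \<open>x \<ge> 0\<close> pantograph_continuous_on[OF H] in auto)
qed

section \<open>Existence\<close>

text \<open>\<open>D n\<close> is the \<open>n\<close>-th derivative of a function on the line supported in \<open>{1..l}\<close>.\<close>
locale flat_bump =
  fixes l \<delta> :: real and D :: "nat \<Rightarrow> real \<Rightarrow> real"
  assumes l: "l > 1" and \<delta>: "\<delta> \<noteq> 0"
    and D_deriv: "\<And>n x. (D n has_real_derivative D (Suc n) x) (at x)"
    and D_left: "\<And>n x. x \<le> 1 \<Longrightarrow> D n x = 0"
    and D_right: "\<And>n x. x \<ge> l \<Longrightarrow> D n x = 0"
begin

text \<open>The recursion makes \<open>rterm (Suc k) (l * x)\<close> equal to \<open>\<delta> / l\<close> times the derivative of \<open>rterm k\<close>
  at \<open>x\<close>; the factor \<open>1 / l ^ k\<close> is the inner derivative of \<open>x / l ^ k\<close>.\<close>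
primrec coef :: "nat \<Rightarrow> real" where
  "coef 0 = 1"
| "coef (Suc k) = coef k * (\<delta> / l) / l ^ k"

definition rterm :: "nat \<Rightarrow> real \<Rightarrow> real" where
  "rterm k x = coef k * D k (x / l ^ k)"

text \<open>The antiderivative is normalised to vanish on \<open>{1..}\<close>. It is written with two integrals from 0
  because the integral over \<open>{l..l * x}\<close> would be 0, not the negated integral, for \<open>x < 1\<close>.\<close>
primrec lterm :: "nat \<Rightarrow> real \<Rightarrow> real" where
  "lterm 0 = D 0"
| "lterm (Suc j) = (\<lambda>x. (integral {0..l * x} (lterm j) - integral {0..l} (lterm j)) / \<delta>)"

definition rpart :: "real \<Rightarrow> real" where
  "rpart x = (\<Sum>k. rterm k x)"

text \<open>The sum starts at index 1: the term \<open>lterm 0\<close> is \<open>rterm 0\<close>, which \<open>rpart\<close> already contains.\<close>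
definition lpart :: "real \<Rightarrow> real" where
  "lpart x = (\<Sum>j. lterm (Suc j) x)"

lemma rterm_eq_0: "x \<le> l ^ k \<Longrightarrow> rterm k x = 0"
  using l D_left[of "x / l ^ k" k] by (simp add: rterm_def)

lemma rpart_eq_sum:
  assumes "x \<le> l ^ N"
  shows "rpart x = (\<Sum>k<N. rterm k x)"
  unfolding rpart_def
proof (rule suminf_finite)
  fix k assume "k \<notin> {..<N}"
  then have "l ^ N \<le> l ^ k" using l by (intro power_increasing) auto
  then show "rterm k x = 0" using assms by (intro rterm_eq_0) simp
qed simp

lemma rterm_deriv:
  "(rterm k has_real_derivative l / \<delta> * rterm (Suc k) (l * x)) (at x)"
proof -
  have "((\<lambda>x. x / l ^ k) has_real_derivative 1 / l ^ k) (at x)"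
    using l by (auto intro!: derivative_eq_intros)
  then have "((\<lambda>x. D k (x / l ^ k)) has_real_derivative D (Suc k) (x / l ^ k) * (1 / l ^ k)) (at x)"
    by (rule DERIV_chain2[OF D_deriv])
  then have "((\<lambda>x. coef k * D k (x / l ^ k)) has_real_derivative
      coef k * (D (Suc k) (x / l ^ k) * (1 / l ^ k))) (at x)"
    by (rule DERIV_cmult)
  moreover have "coef k * (D (Suc k) (x / l ^ k) * (1 / l ^ k)) = l / \<delta> * rterm (Suc k) (l * x)"
    using l \<delta> by (simp add: rterm_def)
  ultimately show ?thesis by (simp add: rterm_def[abs_def])
qed

text \<open>The summand \<open>D 0\<close> is subtracted since the shifted series misses its term at index 0; the
  derivative of \<open>lpart\<close> supplies it again.\<close>
lemma rpart_deriv: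
  "(rpart has_real_derivative l / \<delta> * (rpart (l * x) - D 0 (l * x))) (at x)"
proof -
  obtain N where N: "x < l ^ N" using real_arch_pow[OF l] by blast
  have "((\<lambda>x. \<Sum>k<N. rterm k x) has_real_derivative (\<Sum>k<N. l / \<delta> * rterm (Suc k) (l * x))) (at x)"
    by (intro DERIV_sum rterm_deriv)
  then have "(rpart has_real_derivative (\<Sum>k<N. l / \<delta> * rterm (Suc k) (l * x))) (at x)"
    by (rule has_field_derivative_transform_within_open[where S = "{..<l ^ N}"])
      (use N rpart_eq_sum[of _ N, symmetric] in auto)
  moreover have "rpart (l * x) = D 0 (l * x) + (\<Sum>k<N. rterm (Suc k) (l * x))"
    using N l by (subst rpart_eq_sum[of _ "Suc N"])
      (simp_all add: sum.lessThan_Suc_shift rterm_def[of 0] del: sum.lessThan_Suc)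
  ultimately show ?thesis by (simp add: sum_distrib_left)
qed

text \<open>Each term is differentiable because the previous one is continuous, and so the two claims
  are established together.\<close>
lemma lterm_continuous_deriv:
  shows lterm_continuous: "continuous_on {0..} (lterm j)"
    and lterm_deriv: "x \<ge> 0 \<Longrightarrow>
      (lterm (Suc j) has_real_derivative l / \<delta> * lterm j (l * x)) (at x within {0..})"
proof -
  have step: "(lterm (Suc j) has_real_derivative l / \<delta> * lterm j (l * x)) (at x within {0..})"
    if "continuous_on {0..} (lterm j)" "x \<ge> 0" for j x
  proof -
    have "((\<lambda>x. integral {0..l * x} (lterm j)) has_real_derivative lterm j (l * x) * l) (at x within {0..})"
      using integral_has_real_derivative_half_line[OF that(1), of "l * x"] that(2) l
      by (intro has_real_derivative_dilation_half_line[where F = "\<lambda>x. integral {0..x} (lterm j)"]) auto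
    then show ?thesis using \<delta> by (auto intro!: derivative_eq_intros)
  qed
  show cont: "continuous_on {0..} (lterm j)" for j
  proof (induction j)
    case 0
    show ?case using D_deriv by (auto intro: DERIV_continuous_on has_field_derivative_at_within)
  next
    case (Suc j)
    then show ?case using step by (intro DERIV_continuous_on[of _ "lterm (Suc j)"]) auto
  qed
  show "x \<ge> 0 \<Longrightarrow> (lterm (Suc j) has_real_derivative l / \<delta> * lterm j (l * x)) (at x within {0..})"
    by (rule step[OF cont])
qed

text \<open>Beyond the support of \<open>lterm j\<close> both integrals in the next term equal the full integral, so their
  difference vanishes; as the argument is dilated, the support shrinks by the factor \<open>l\<close>.\<close>
lemma lterm_eq_0: "x \<ge> l / l ^ j \<Longrightarrow> lterm j x = 0"
proof (induction j arbitrary: x)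
  case 0
  then show ?case using D_right by simp
next
  case (Suc j)
  let ?s = "l / l ^ j"
  have s: "0 \<le> ?s" "?s \<le> l" "?s \<le> l * x"
    using l Suc.prems by (auto simp: field_simps)
  have "integral {0..b} (lterm j) = integral {0..?s} (lterm j)" if "b \<ge> ?s" for b
    using s that Suc.IH by (intro integral_Icc_eq_of_vanishing lterm_continuous) auto
  from this[OF s(2)] this[OF s(3)] show ?case by simp
qed

text \<open>Each of the two integrals in \<open>lterm (Suc j)\<close> is at most the bound for \<open>lterm j\<close> times the length
  \<open>l / l ^ j\<close> of its support in the half-line.\<close>
primrec lbound :: "real \<Rightarrow> nat \<Rightarrow> real" where
  "lbound M 0 = M"
| "lbound M (Suc j) = lbound M j * (2 * (l / l ^ j) / \<bar>\<delta>\<bar>)"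

lemma lterm_bounded:
  assumes "\<And>x. \<bar>D 0 x\<bar> \<le> M" "x \<ge> 0"
  shows "\<bar>lterm j x\<bar> \<le> lbound M j"
  using assms(2)
proof (induction j arbitrary: x)
  case 0
  then show ?case using assms(1) by simp
next
  case (Suc j)
  let ?s = "l / l ^ j"
  have s: "0 \<le> ?s" using l by simp
  have "\<bar>lterm j 0\<bar> \<le> lbound M j" using Suc.IH by simp
  then have nn: "0 \<le> lbound M j" by linarith
  have small: "\<bar>integral {0..b} (lterm j)\<bar> \<le> lbound M j * ?s" if b: "0 \<le> b" "b \<le> ?s" for b
  proof -
    have "norm (integral {0..b} (lterm j)) \<le> lbound M j * (b - 0)"
      by (rule integral_bound)
        (use b Suc.IH continuous_on_subset[OF lterm_continuous[of j]] in auto)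
    also have "\<dots> \<le> lbound M j * ?s" using b nn by (intro mult_left_mono) auto
    finally show ?thesis by simp
  qed
  have int: "\<bar>integral {0..b} (lterm j)\<bar> \<le> lbound M j * ?s" if b: "0 \<le> b" for b
  proof (cases "b \<le> ?s")
    case True
    then show ?thesis using small b by blast
  next
    case False
    then have "integral {0..b} (lterm j) = integral {0..?s} (lterm j)"
      using s lterm_eq_0 by (intro integral_Icc_eq_of_vanishing lterm_continuous) auto
    then show ?thesis using small[of ?s] s by simp
  qed
  have "\<bar>integral {0..l * x} (lterm j) - integral {0..l} (lterm j)\<bar> \<le> 2 * (lbound M j * ?s)"
    using int[of "l * x"] int[of l] l Suc.prems by (simp add: abs_le_iff)
  then have "\<bar>integral {0..l * x} (lterm j) - integral {0..l} (lterm j)\<bar> / \<bar>\<delta>\<bar>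
      \<le> 2 * (lbound M j * ?s) / \<bar>\<delta>\<bar>"
    by (rule divide_right_mono) simp
  moreover have "2 * (lbound M j * ?s) / \<bar>\<delta>\<bar> = lbound M (Suc j)"
    unfolding lbound.simps by (simp only: mult.left_commute times_divide_eq_right)
  ultimately show ?case unfolding lterm.simps abs_divide by (simp only:)
qed

text \<open>The supports shrink geometrically, so the quotients of consecutive bounds tend to 0.\<close>
lemma summable_lbound: "summable (lbound M)"
proof -
  obtain N where N: "4 * l / \<bar>\<delta>\<bar> < l ^ N" using real_arch_pow[OF l] by blast
  show ?thesis
  proof (rule summable_ratio_test[of "1/2" N])
    fix n assume "n \<ge> N"
    then have "l ^ N \<le> l ^ n" using l by (intro power_increasing) auto
    then have "4 * l / \<bar>\<delta>\<bar> \<le> l ^ n" using N by linarith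
    then have "4 * l / \<bar>\<delta>\<bar> / l ^ n \<le> 1" using l by (simp only: divide_le_eq_1) simp
    then have "2 * (l / l ^ n) / \<bar>\<delta>\<bar> \<le> 1 / 2" by (simp add: mult.commute)
    then have "norm (lbound M n) * (2 * (l / l ^ n) / \<bar>\<delta>\<bar>) \<le> norm (lbound M n) * (1 / 2)"
      by (intro mult_left_mono) auto
    then show "norm (lbound M (Suc n)) \<le> 1 / 2 * norm (lbound M n)"
      using l by (simp add: abs_mult)
  qed simp
qed

lemma D_bounded: "\<exists>M. \<forall>x. \<bar>D 0 x\<bar> \<le> M"
proof -
  have "continuous_on {1..l} (D 0)"
    using D_deriv by (auto intro: DERIV_continuous_on has_field_derivative_at_within)
  then have "bounded (D 0 ` {1..l})"
    by (intro compact_imp_bounded compact_continuous_image) auto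
  then obtain M where M: "\<And>x. x \<in> {1..l} \<Longrightarrow> \<bar>D 0 x\<bar> \<le> M"
    unfolding bounded_iff by (auto simp del: atLeastAtMost_iff)
  have "\<bar>D 0 x\<bar> \<le> M" for x
  proof (cases "x \<in> {1..l}")
    case False
    then have "D 0 x = 0" using D_left[of x 0] D_right[of x 0] by force
    moreover have "0 \<le> M" using M[of 1] l by simp
    ultimately show ?thesis by simp
  qed (rule M)
  then show ?thesis by blast
qed

text \<open>The series of derivatives is dominated by \<open>lbound\<close> uniformly on the closed half-line, so
  termwise differentiation is valid at 0 too, where infinitely many terms contribute.\<close>
lemma lpart_deriv:
  assumes "x \<ge> 0"
  shows "(lpart has_real_derivative l / \<delta> * (lpart (l * x) + D 0 (l * x))) (at x within {0..})"
proof -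
  obtain M where M: "\<And>x. \<bar>D 0 x\<bar> \<le> M" using D_bounded by blast
  have summable: "summable (\<lambda>j. lterm j x)" if "x \<ge> 0" for x
    by (rule summable_comparison_test'[OF summable_lbound[of M], of 0])
      (use lterm_bounded[OF M that] in auto)
  let ?g' = "\<lambda>x. \<Sum>j. l / \<delta> * lterm j (l * x)"
  have "uniform_limit {0..} (\<lambda>n x. \<Sum>j<n. l / \<delta> * lterm j (l * x)) ?g' sequentially"
  proof (rule Weierstrass_m_test)
    show "summable (\<lambda>j. \<bar>l / \<delta>\<bar> * lbound M j)" by (intro summable_mult summable_lbound)
    show "norm (l / \<delta> * lterm j (l * x)) \<le> \<bar>l / \<delta>\<bar> * lbound M j" if "x \<in> {0..}" for j x
      unfolding real_norm_def abs_mult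
      using that l by (intro mult_left_mono lterm_bounded M) auto
  qed
  moreover have "summable (\<lambda>j. lterm (Suc j) 0)"
    using summable[of 0] summable_Suc_iff[of "\<lambda>j. lterm j 0"] by (simp del: lterm.simps)
  ultimately obtain g where g: "\<And>x. x \<in> {0..} \<Longrightarrow> (\<lambda>j. lterm (Suc j) x) sums g x"
    "\<And>x. x \<in> {0..} \<Longrightarrow> (g has_real_derivative ?g' x) (at x within {0..})"
    using has_field_derivative_series[of "{0..}" "\<lambda>j. lterm (Suc j)"
        "\<lambda>j x. l / \<delta> * lterm j (l * x)" ?g' 0] lterm_deriv
    by (auto simp del: lterm.simps)
  have eq: "lpart y = g y" if "y \<ge> 0" for y
    using g(1)[of y] that by (simp add: lpart_def sums_iff del: lterm.simps)
  have "(lpart has_real_derivative ?g' x) (at x within {0..})"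
    by (rule has_field_derivative_transform_within[OF g(2), of _ 1]) (use assms eq in auto)
  moreover have "?g' x = l / \<delta> * (lpart (l * x) + D 0 (l * x))"
  proof -
    have s: "summable (\<lambda>j. lterm j (l * x))" using summable assms l by simp
    have "?g' x = l / \<delta> * (\<Sum>j. lterm j (l * x))" by (rule suminf_mult[OF s])
    also have "(\<Sum>j. lterm j (l * x)) = lpart (l * x) + D 0 (l * x)"
      using suminf_split_head[OF s] by (simp add: lpart_def del: lterm.simps(2))
    finally show ?thesis .
  qed
  ultimately show ?thesis by simp
qed

lemma pantograph_solution: "pantograph l \<delta> (\<lambda>x. rpart x + lpart x)"
  unfolding pantograph_def
proof (intro allI impI)
  fix x :: real assume "x \<ge> 0"
  then have "((\<lambda>x. rpart x + lpart x) has_real_derivative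
      l / \<delta> * (rpart (l * x) - D 0 (l * x)) + l / \<delta> * (lpart (l * x) + D 0 (l * x))) (at x within {0..})"
    by (intro DERIV_add has_field_derivative_at_within[OF rpart_deriv] lpart_deriv)
  then show "((\<lambda>x. rpart x + lpart x) has_real_derivative
      l / \<delta> * (rpart (l * x) + lpart (l * x))) (at x within {0..})"
    by (simp add: algebra_simps)
qed

lemma solution_extends:
  assumes "x \<in> {1..l}"
  shows "rpart x + lpart x = D 0 x"
proof -
  have "rpart x = D 0 x"
    using rpart_eq_sum[of x 1] assms by (simp add: rterm_def)
  moreover have "lterm (Suc j) x = 0" for j
  proof (rule lterm_eq_0)
    have "l / l ^ Suc j \<le> 1" using l by (simp add: field_simps)
    also have "1 \<le> x" using assms by simp
    finally show "l / l ^ Suc j \<le> x" .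
  qed
  ultimately show ?thesis by (simp add: lpart_def del: lterm.simps)
qed

end

section \<open>Extension by zero and the theorem\<close>

lemma has_real_derivative_Un:
  assumes "(g has_real_derivative d) (at x within S)" "(g has_real_derivative d) (at x within T)"
  shows "(g has_real_derivative d) (at x within S \<union> T)"
  using assms unfolding has_field_derivative_iff by (simp add: at_within_union filterlim_sup)

text \<open>At the two endpoints the one-sided derivatives from inside and outside both vanish; this is where
  the flatness of \<open>f\<close> enters.\<close>
lemma extension_by_zero_deriv:
  fixes l :: real and f :: "real \<Rightarrow> real"
  defines "D \<equiv> \<lambda>n x. if x \<in> {1..l} then nth_deriv_within {1..l} n f x else 0"
  assumes "l > 1" "smooth_on {1..l} f"
    and left: "\<And>n. nth_deriv_within {1..l} n f 1 = 0"
    and right: "\<And>n. nth_deriv_within {1..l} n f l = 0"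
  shows "(D n has_real_derivative D (Suc n) x) (at x)"
proof -
  have inner: "(D n has_real_derivative D (Suc n) x) (at x within {1..l})" if x: "x \<in> {1..l}"
  proof -
    have "nth_deriv_within {1..l} n f differentiable (at x within {1..l})"
      using assms(3) x by (auto simp: smooth_on_def differentiable_on_def)
    then have "(nth_deriv_within {1..l} n f has_real_derivative D (Suc n) x) (at x within {1..l})"
      using x by (simp add: D_def vector_derivative_works has_real_derivative_iff_has_vector_derivative)
    then show ?thesis
      by (rule has_field_derivative_transform_within[of _ _ _ _ 1]) (use x in \<open>auto simp: D_def\<close>)
  qed
  have zero: "D m y = 0" if "y \<notin> {1<..<l}" for m y
    using that left right unfolding D_def by (cases "y = 1"; cases "y = l") auto
  have outer: "(D n has_real_derivative D (Suc n) x) (at x within - {1<..<l})"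
    if x: "x \<notin> {1<..<l}"
    unfolding zero[OF x]
    by (rule has_field_derivative_transform_within[of "\<lambda>_. 0" _ _ _ 1]) (use x zero in auto)
  consider "x \<in> {1<..<l}" | "x \<notin> {1..l}" | "x \<in> {1..l}" "x \<notin> {1<..<l}" by blast
  then show ?thesis
  proof cases
    case 1
    then show ?thesis using inner at_within_interior[of x "{1..l}"] by simp
  next
    case 2
    then have "x \<in> interior (- {1<..<l})"
      by (intro interiorI[of "- {1..l}"]) auto
    with 2 show ?thesis using outer at_within_interior[of x "- {1<..<l}"] by auto
  next
    case 3
    have "{1..l} \<union> - {1<..<l} = UNIV" by auto
    then show ?thesis using has_real_derivative_Un[OF inner[OF 3(1)] outer[OF 3(2)]] by simp
  qed
qed

theorem mainTheorem1:
  fixes l \<delta> :: real and f :: "real \<Rightarrow> real"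
  assumes "l > 1" and "\<delta> \<noteq> 0"
    and "smooth_on {1..l} f"
    and "\<And>n. nth_deriv_within {1..l} n f 1 = 0"
    and "\<And>n. nth_deriv_within {1..l} n f l = 0"
  shows "\<exists>F. smooth_solution_extending l \<delta> f F \<and>
    (\<forall>G. smooth_solution_extending l \<delta> f G \<longrightarrow> (\<forall>x\<ge>0. G x = F x))"
proof -
  define D where "D n x = (if x \<in> {1..l} then nth_deriv_within {1..l} n f x else 0)" for n x
  interpret flat_bump l \<delta> D
  proof
    show "(D n has_real_derivative D (Suc n) x) (at x)" for n x
      using extension_by_zero_deriv[OF assms(1,3,4,5)] unfolding D_def[abs_def] by simp
    show "D n x = 0" if "x \<le> 1" for n x
      using that assms(4)[of n] by (cases "x = 1") (auto simp: D_def)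
    show "D n x = 0" if "x \<ge> l" for n x
      using that assms(5)[of n] by (cases "x = l") (auto simp: D_def)
  qed (fact assms)+
  define F where "F x = rpart x + lpart x" for x
  have F: "pantograph l \<delta> F"
    using pantograph_solution by (simp add: F_def[abs_def])
  have Ff: "F x = f x" if "x \<in> {1..l}" for x
    using solution_extends[OF that] that by (simp add: F_def D_def)
  show ?thesis
  proof (intro exI[of _ F] conjI allI impI)
    show "smooth_solution_extending l \<delta> f F"
      unfolding smooth_solution_extending_def
      using F Ff assms(1,2) pantograph_smooth_on[of l] integral_equation_if_pantograph[of l] by simp
  next
    fix G and x :: real
    assume G: "smooth_solution_extending l \<delta> f G" and x: "x \<ge> 0"
    have "nth_deriv_within {0..} 0 G differentiable_on {0..}"
      using G unfolding smooth_solution_extending_def smooth_on_def by blast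
    then have "continuous_on {0..} G"
      by (simp add: differentiable_imp_continuous_on)
    then have "pantograph l \<delta> G"
      using G assms(1,2) by (intro pantograph_if_integral_equation)
        (auto simp: smooth_solution_extending_def)
    then have "pantograph l \<delta> (\<lambda>x. G x - F x)"
      using F by (rule pantograph_diff)
    then have "G x - F x = 0"
      by (rule pantograph_zero[OF assms(1,2)])
        (use G Ff x in \<open>auto simp: smooth_solution_extending_def\<close>)
    then show "G x = F x" by simp
  qed
qed

end
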